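(* For every integer $n\ge 1$, $$E_{2n}=1-\sum_{k=0}^{n-1}2^{2(n-k)-1}\binom{2n}{2k}E_{2k}.$$
   Context: The Euler numbers $E_m$ are defined by $\frac{1}{\cosh t}=\sum_{m=0}^\infty E_m\frac{t^m}{m!}$ for $|t|<\pi/2$ (so $E_0=1$, $E_2=-1$, $E_4=5$, and odd-index Euler numbers vanish). *)

theory Defs
  imports "HOL-Complex_Analysis.Complex_Analysis"
begin

text \<open>
  The description picks the whole coefficient sequence; \<open>ex1_euler_number\<close> below shows that
  this sequence exists and is unique, so that the definition is proper.
\<close>

definition euler_number :: "nat \<Rightarrow> real" where
  "euler_number = (THE E. \<forall>t::real. \<bar>t\<bar> < pi / 2 \<longrightarrow>
     (\<lambda>m. E m * (t ^ m / fact m)) sums (1 / cosh t))"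

lemma cosh_nonzero_in_ball:
  fixes z :: complex
  assumes "z \<in> ball 0 (pi / 2)"
  shows "cosh z \<noteq> 0"
proof
  assume "cosh z = 0"
  then obtain n :: int where n: "\<i> * z = complex_of_real (n * pi) + of_real pi / 2"
    unfolding cosh_conv_cos cos_eq_0 by blast
  have "\<i> * z = complex_of_real ((n + 1 / 2) * pi)"
    by (simp add: n algebra_simps)
  then have "norm z = \<bar>(n + 1 / 2) * pi\<bar>"
    by (metis norm_mult norm_ii mult_1 norm_of_real)
  moreover have "1 / 2 \<le> \<bar>of_int n + 1 / 2 :: real\<bar>"
    by (cases "n \<ge> 0") auto
  ultimately have "norm z \<ge> 1 / 2 * pi"
    unfolding abs_mult by (simp add: mult_right_mono)
  with assms show False by simp
qed

lemma ex1_euler_number: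
  "\<exists>!E. \<forall>t::real. \<bar>t\<bar> < pi / 2 \<longrightarrow> (\<lambda>m. E m * (t ^ m / fact m)) sums (1 / cosh t)"
proof (rule ex_ex1I)
  define f :: "complex \<Rightarrow> complex" where "f = (\<lambda>z. 1 / cosh z)"
  have cosh_hol: "(cosh :: complex \<Rightarrow> complex) holomorphic_on ball 0 (pi / 2)"
    unfolding cosh_field_def by (intro holomorphic_intros) auto
  have hol: "f holomorphic_on ball 0 (pi / 2)"
    unfolding f_def by (intro holomorphic_intros cosh_hol cosh_nonzero_in_ball)
  have "(\<lambda>m. Re ((deriv ^^ m) f 0) * (t ^ m / fact m)) sums (1 / cosh t)"
    if "\<bar>t\<bar> < pi / 2" for t :: real
  proof -
    have "complex_of_real t \<in> ball 0 (pi / 2)"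
      using that by simp
    from holomorphic_power_series[OF hol this]
    have "(\<lambda>m. (deriv ^^ m) f 0 / fact m * of_real t ^ m) sums f (of_real t)"
      by simp
    then have "(\<lambda>m. Re ((deriv ^^ m) f 0 / fact m * of_real t ^ m)) sums Re (f (of_real t))"
      by (rule sums_Re)
    moreover have "Re ((deriv ^^ m) f 0 / fact m * of_real t ^ m)
        = Re ((deriv ^^ m) f 0) * (t ^ m / fact m)" for m
    proof -
      have "(deriv ^^ m) f 0 / fact m * of_real t ^ m
          = (deriv ^^ m) f 0 * complex_of_real (t ^ m / fact m)"
        by simp
      then show ?thesis by (metis Re_complex_of_real Im_complex_of_real times_complex.sel(1) mult_zero_right diff_zero)
    qed
    moreover have "f (of_real t) = of_real (1 / cosh t)"
      unfolding f_def cosh_field_def by (simp add: exp_of_real flip: of_real_minus)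
    ultimately show ?thesis by simp
  qed
  then show "\<exists>E. \<forall>t::real. \<bar>t\<bar> < pi / 2 \<longrightarrow> (\<lambda>m. E m * (t ^ m / fact m)) sums (1 / cosh t)"
    by (intro exI[of _ "\<lambda>m. Re ((deriv ^^ m) f 0)"]) blast
next
  fix E F :: "nat \<Rightarrow> real"
  assume E: "\<forall>t::real. \<bar>t\<bar> < pi / 2 \<longrightarrow> (\<lambda>m. E m * (t ^ m / fact m)) sums (1 / cosh t)"
    and F: "\<forall>t::real. \<bar>t\<bar> < pi / 2 \<longrightarrow> (\<lambda>m. F m * (t ^ m / fact m)) sums (1 / cosh t)"
  define a where "a = (\<lambda>m. (E m - F m) / fact m)"
  have sm: "(\<lambda>m. a m * (t - 0) ^ m) sums 0" if "norm (t - 0) < pi / 2" for t :: real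
  proof -
    have "(\<lambda>m. E m * (t ^ m / fact m) - F m * (t ^ m / fact m)) sums (1 / cosh t - 1 / cosh t)"
      using that E F by (intro sums_diff) auto
    then show ?thesis
      by (simp add: a_def algebra_simps diff_divide_distrib)
  qed
  have "a m = 0" for m
  proof (cases "m = 0")
    case True
    then show ?thesis using sm[of 0] by simp
  next
    case False
    show ?thesis
    proof (rule ccontr)
      assume "a m \<noteq> 0"
      with False obtain s where "0 < s" "\<And>z. z \<in> cball (0::real) s - {0} \<Longrightarrow> (0::real) \<noteq> 0"
        using powser_0_nonzero[of "pi / 2" 0 a "\<lambda>_. 0" m] sm by (metis gr0I pi_half_gt_zero)
      moreover from this(1) have "s \<in> cball 0 s - {0}" by simp
      ultimately show False by blast
    qed
  qed
  then show "E = F"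
    by (intro ext) (simp add: a_def)
qed

lemma euler_number_sums:
  fixes t :: real
  assumes "\<bar>t\<bar> < pi / 2"
  shows "(\<lambda>m. euler_number m * (t ^ m / fact m)) sums (1 / cosh t)"
  using theI'[OF ex1_euler_number] assms unfolding euler_number_def by blast

end

theory Submission
  imports Defs
begin

text \<open>
  The recurrence is the coefficient form of the identity
  \<open>cosh (2 t) / cosh t = 2 cosh t - 1 / cosh t\<close>, which is the double angle formula \<open>cosh (2 t) = 2 (cosh t)\<^sup>2 - 1\<close> divided by \<open>cosh t\<close>.
  Every factor is a convergent power series near \<open>0\<close>, so the identity holds between formal power
  series (\<open>euler_fps_mult_cosh\<close>). At \<open>t ^ (2 * n)\<close>, multiplied by \<open>fact (2 * n)\<close>, the left-hand
  side gives the binomial convolution of the Euler numbers with the powers \<open>2 ^ (2 * n - i)\<close>, in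
  which only even \<open>i\<close> survive because \<open>cosh\<close> is even; the right-hand side gives
  \<open>2 - euler_number (2 * n)\<close>. The last term of the convolution is another \<open>euler_number (2 * n)\<close>;
  collecting the two and halving turns the weights \<open>2 ^ (2 * (n - k))\<close> into
  \<open>2 ^ (2 * (n - k) - 1)\<close>.
\<close>

text \<open>
  Nonzero power series have isolated zeros, so the difference of two expansions of the same
  function has to be the zero series.
\<close>

lemma has_fps_expansion_unique:
  fixes F G :: "'a :: {banach, real_normed_field} fps"
  assumes "f has_fps_expansion F" "f has_fps_expansion G"
  shows "F = G"
proof (rule ccontr)
  define D where "D = F - G"
  assume "F \<noteq> G"
  then have "D \<noteq> 0"
    by (simp add: D_def)
  then obtain m where m: "fps_nth D m \<noteq> 0"
    by (auto simp: fps_eq_iff)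
  have "(\<lambda>x. f x - f x) has_fps_expansion D"
    unfolding D_def by (intro has_fps_expansion_diff assms)
  then have radius: "fps_conv_radius D > 0" and zero: "\<forall>\<^sub>F z in nhds 0. eval_fps D z = 0"
    by (auto simp: has_fps_expansion_def)
  from radius obtain r where r: "0 < r" "ereal r < fps_conv_radius D"
    by (metis ereal_dense2 zero_ereal_def ereal_less(2))
  have sums: "(\<lambda>k. fps_nth D k * (z - 0) ^ k) sums eval_fps D z" if "norm (z - 0) < r" for z
    using sums_eval_fps[of z D] that r by (metis diff_zero ereal_less_le less_ereal.simps(1)
      less_imp_le order.strict_trans)
  have "fps_nth D 0 = 0"
    using eventually_nhds_x_imp_x[OF zero] by (simp add: eval_fps_at_0)
  with m have "m > 0"
    by (cases m) auto
  moreover have "eval_fps D 0 = 0"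
    using eventually_nhds_x_imp_x[OF zero] by simp
  \<comment> \<open>Some coefficient of positive degree is nonzero, so \<open>0\<close> is an isolated zero of \<open>D\<close>.\<close>
  ultimately obtain s where s: "0 < s" "\<And>z. z \<in> cball 0 s - {0} \<Longrightarrow> eval_fps D z \<noteq> 0"
    using powser_0_nonzero[OF \<open>0 < r\<close> sums, of m] m by blast
  from zero obtain e where e: "0 < e" "\<And>z. norm z < e \<Longrightarrow> eval_fps D z = 0"
    by (auto simp: eventually_nhds_metric)
  define z :: 'a where "z = of_real (min s (e / 2))"
  have "norm z \<le> s" "norm z < e" "z \<noteq> 0"
    using s(1) e(1) by (auto simp: z_def min_def)
  with s(2)[of z] e(2)[of z] show False
    by simp
qed

definition euler_fps :: "real fps" where
  "euler_fps = Abs_fps (\<lambda>m. euler_number m / fact m)"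

lemma has_fps_expansion_inverse_cosh: "(\<lambda>t. 1 / cosh t) has_fps_expansion euler_fps"
proof (rule has_fps_expansionI)
  have "\<forall>\<^sub>F t in nhds 0. t \<in> {- (pi / 2)<..<pi / 2}"
    by (intro eventually_nhds_in_open) auto
  then show "\<forall>\<^sub>F t in nhds 0. (\<lambda>n. fps_nth euler_fps n * t ^ n) sums (1 / cosh t)"
  proof eventually_elim
    case (elim t)
    then have "\<bar>t\<bar> < pi / 2"
      by auto
    then show ?case
      using euler_number_sums[of t] by (simp add: euler_fps_def)
  qed
qed

definition cosh_fps :: "real \<Rightarrow> real fps" where
  "cosh_fps c = Abs_fps (\<lambda>n. if even n then c ^ n / fact n else 0)"

lemma has_fps_expansion_cosh: "(\<lambda>t. cosh (c * t)) has_fps_expansion cosh_fps c"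
proof -
  have "(\<lambda>t. 1 / 2 * (exp (c * t) + exp (- c * t))) has_fps_expansion
      fps_const (1 / 2) * (fps_exp c + fps_exp (- c))"
    by (intro fps_expansion_intros)
  also have "fps_const (1 / 2) * (fps_exp c + fps_exp (- c)) = cosh_fps c"
    by (auto simp: fps_eq_iff cosh_fps_def)
  also have "(\<lambda>t. 1 / 2 * (exp (c * t) + exp (- c * t))) = (\<lambda>t. cosh (c * t))"
    by (simp add: fun_eq_iff cosh_field_def)
  finally show ?thesis .
qed

text \<open>
  Both sides expand \<open>cosh (2 * t) / cosh t\<close>: on the right, the double angle formula is divided
  by \<open>cosh t\<close>.
\<close>

lemma euler_fps_mult_cosh: "euler_fps * cosh_fps 2 = 2 * cosh_fps 1 - euler_fps"
proof (rule has_fps_expansion_unique)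
  show "(\<lambda>t. 1 / cosh t * cosh (2 * t)) has_fps_expansion euler_fps * cosh_fps 2"
    by (intro has_fps_expansion_mult has_fps_expansion_inverse_cosh has_fps_expansion_cosh)
  have "(\<lambda>t. 2 * cosh (1 * t) - 1 / cosh t) has_fps_expansion 2 * cosh_fps 1 - euler_fps"
    by (intro has_fps_expansion_diff has_fps_expansion_mult has_fps_expansion_numeral
        has_fps_expansion_inverse_cosh has_fps_expansion_cosh)
  also have "(\<lambda>t. 2 * cosh (1 * t) - 1 / cosh t) = (\<lambda>t::real. 1 / cosh t * cosh (2 * t))"
  proof
    fix t :: real
    have "cosh t \<noteq> 0"
      by (metis cosh_real_pos less_irrefl)
    then show "2 * cosh (1 * t) - 1 / cosh t = 1 / cosh t * cosh (2 * t)"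
      unfolding cosh_double_cosh by (simp add: field_simps power2_eq_square)
  qed
  finally show "(\<lambda>t. 1 / cosh t * cosh (2 * t)) has_fps_expansion 2 * cosh_fps 1 - euler_fps" .
qed

text \<open>
  The series of \<open>cosh (2 * t)\<close> vanishes at odd degrees, so in the Cauchy product at degree
  \<open>2 * n\<close> only the even degrees \<open>2 * k\<close> of the first factor contribute.
\<close>

lemma euler_number_convolution:
  "(\<Sum>k\<le>n. 2 ^ (2 * (n - k)) * real ((2 * n) choose (2 * k)) * euler_number (2 * k)) =
    2 - euler_number (2 * n)"
proof -
  define a where "a i = euler_number i / fact i * fps_nth (cosh_fps 2) (2 * n - i)" for i
  have "(\<Sum>k\<le>n. 2 ^ (2 * (n - k)) * real ((2 * n) choose (2 * k)) * euler_number (2 * k)) =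
      fact (2 * n) * (\<Sum>k\<le>n. a (2 * k))"
    unfolding sum_distrib_left
  proof (rule sum.cong)
    fix k assume "k \<in> {..n}"
    then have "k \<le> n" by simp
    then have "real ((2 * n) choose (2 * k)) =
        fact (2 * n) / (fact (2 * k) * fact (2 * n - 2 * k))"
      by (intro binomial_fact) simp
    then show "2 ^ (2 * (n - k)) * real ((2 * n) choose (2 * k)) * euler_number (2 * k) =
        fact (2 * n) * a (2 * k)"
      by (simp add: a_def cosh_fps_def diff_mult_distrib2)
  qed simp
  also have "(\<Sum>k\<le>n. a (2 * k)) = sum a ((\<lambda>k. 2 * k) ` {..n})"
    by (simp add: sum.reindex inj_on_def)
  also have "\<dots> = sum a {0..2 * n}"
  proof (rule sum.mono_neutral_left)
    show "\<forall>i\<in>{0..2 * n} - (\<lambda>k. 2 * k) ` {..n}. a i = 0"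
    proof
      fix i assume i: "i \<in> {0..2 * n} - (\<lambda>k. 2 * k) ` {..n}"
      then have "odd i"
        by (auto elim!: evenE)
      with i show "a i = 0"
        by (simp add: a_def cosh_fps_def)
    qed
  qed auto
  also have "\<dots> = fps_nth (euler_fps * cosh_fps 2) (2 * n)"
    by (simp add: fps_mult_nth a_def euler_fps_def)
  also have "\<dots> = (2 - euler_number (2 * n)) / fact (2 * n)"
    unfolding euler_fps_mult_cosh by (simp add: cosh_fps_def euler_fps_def diff_divide_distrib)
  finally show ?thesis
    by simp
qed

theorem theorem2:
  fixes n :: nat
  assumes "n \<ge> 1"
  shows "euler_number (2 * n) =
    1 - (\<Sum>k = 0..n - 1. 2 ^ (2 * (n - k) - 1) * real ((2 * n) choose (2 * k)) * euler_number (2 * k))"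
proof -
  let ?w = "\<lambda>k. real ((2 * n) choose (2 * k)) * euler_number (2 * k)"
  \<comment> \<open>For \<open>k = n\<close> this fails, as \<open>2 * (n - k) - 1\<close> is truncated to \<open>0\<close>; that summand is split off.\<close>
  have halve: "(2::real) ^ (2 * (n - k)) = 2 * 2 ^ (2 * (n - k) - 1)" if "k < n" for k
    using that by (subst power_Suc[symmetric]) (simp add: Suc_diff_Suc)
  have "{..n} = insert n {0..n - 1}"
    using assms by auto
  then have "(\<Sum>k\<le>n. 2 ^ (2 * (n - k)) * ?w k) =
      euler_number (2 * n) + (\<Sum>k = 0..n - 1. 2 ^ (2 * (n - k)) * ?w k)"
    using assms by simp
  also have "(\<Sum>k = 0..n - 1. 2 ^ (2 * (n - k)) * ?w k) =
      2 * (\<Sum>k = 0..n - 1. 2 ^ (2 * (n - k) - 1) * ?w k)"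
    unfolding sum_distrib_left using assms by (intro sum.cong) (auto simp: halve)
  finally show ?thesis
    using euler_number_convolution[of n] by (simp add: mult.assoc)
qed

end
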